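(* Every finite simple graph $G$ embeds as an induced subgraph into a metamour-complementary self-complementary graph $G'$ with $|V(G')|=4\,|V(G)|+1$.
   Context: The metamour graph $\operatorname{M}(G)$ of a graph $G$ has vertex set $V(G)$, with $x,y$ adjacent if and only if $d_G(x,y)=2$ ($d_G$ is graph distance). $G$ is metamour-complementary if $\operatorname{M}(G)=\overline{G}$ (the complement of $G$), and self-complementary if $G\cong\overline{G}$. *)

theory Defs
  imports
    "Graph_Theory.Pair_Digraph"
    "Graph_Theory.Digraph_Component"
    "Graph_Theory.Digraph_Isomorphism"
    "Graph_Theory.Shortest_Path"
begin

text \<open>
  A finite simple graph is a \<^locale>\<open>pair_graph\<close>: a finite vertex set with a symmetric
  irreflexive set of arcs, an edge between \<open>x\<close> and \<open>y\<close> being the two arcs \<open>(x, y)\<close> and \<open>(y, x)\<close>.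
  The vertex set may be empty.
\<close>

text \<open>
  Shortest-path cost with all arcs of weight 1, i.e. the least number of edges of a walk
  between the two vertices, and infinity if there is none.
\<close>

definition graph_dist :: "'a pair_pre_digraph \<Rightarrow> 'a \<Rightarrow> 'a \<Rightarrow> ereal" where
  "graph_dist G x y = wf_digraph.\<mu> (with_proj G) (\<lambda>_. 1) x y"

definition metamour_graph :: "'a pair_pre_digraph \<Rightarrow> 'a pair_pre_digraph" where
  "metamour_graph G =
    \<lparr> pverts = pverts G,
      parcs = {(x, y). x \<in> pverts G \<and> y \<in> pverts G \<and> graph_dist G x y = 2} \<rparr>"

definition graph_complement :: "'a pair_pre_digraph \<Rightarrow> 'a pair_pre_digraph" where
  "graph_complement G =
    \<lparr> pverts = pverts G,
      parcs = {(x, y). x \<in> pverts G \<and> y \<in> pverts G \<and> x \<noteq> y \<and> (x, y) \<notin> parcs G} \<rparr>"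

definition metamour_complementary :: "'a pair_pre_digraph \<Rightarrow> bool" where
  "metamour_complementary G \<longleftrightarrow> metamour_graph G = graph_complement G"

definition self_complementary :: "'a pair_pre_digraph \<Rightarrow> bool" where
  "self_complementary G \<longleftrightarrow> digraph_iso (with_proj G) (with_proj (graph_complement G))"

definition embeds_induced :: "'a pair_pre_digraph \<Rightarrow> 'b pair_pre_digraph \<Rightarrow> bool" where
  "embeds_induced G G' \<longleftrightarrow>
    (\<exists>H :: 'b pair_pre_digraph.
      induced_subgraph (with_proj H) (with_proj G') \<and> digraph_iso (with_proj G) (with_proj H))"

end

theory Submission
  imports Defs
begin

text \<open>
  The graph \<open>G'\<close> is a substitution into the pentagon. The pentagon is the Paley graph on
  \<open>\<int>/5\<close>: distinct residues are adjacent when their difference is a nonzero square, that is \<open>\<plusminus>1\<close>.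
  Multiplication by the non-square 2 exchanges adjacency and non-adjacency; it fixes 0 and
  permutes the other residues in the cycle \<open>1 \<rightarrow> 2 \<rightarrow> 4 \<rightarrow> 3 \<rightarrow> 1\<close>, which alternates between squares
  and non-squares. Keep one vertex at 0, replace the vertices 1 and 4 by copies of \<open>G\<close> and the
  vertices 2 and 3 by copies of the complement of \<open>G\<close>. Doubling the residue, with the index of a
  vertex within its copy kept, sends copies of \<open>G\<close> to copies of its complement and conversely, so
  it is an isomorphism from \<open>G'\<close> to the complement of \<open>G'\<close> (lemma \<open>arcs_blowup_turn\<close>).

  A graph is metamour-complementary as soon as any two distinct non-adjacent vertices have a common
  neighbour (lemma \<open>metamour_complementaryI\<close>). In the pentagon, distinct non-adjacent vertices have
  a common neighbour, and every vertex has a neighbour. In \<open>G'\<close>, two non-adjacent vertices over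
  different residues therefore have a common neighbour over the corresponding residue, and two
  vertices over the same residue have all the vertices over a neighbouring residue as common
  neighbours. No residue is left without vertices unless \<open>G\<close> is empty, when \<open>G'\<close> is a single vertex.
\<close>

section \<open>Distance two and isomorphisms\<close>

lemma (in pair_graph) graph_dist_le_length:
  assumes "awalk u p v"
  shows "graph_dist G u v \<le> length p"
proof -
  have "awalk_cost (\<lambda>_. 1) p = length p"
    by (simp add: awalk_cost_def sum_list_triv)
  then show ?thesis
    using min_cost_le_walk_cost[OF assms, of "\<lambda>_. 1"] by (simp add: graph_dist_def)
qed

lemma (in pair_graph) graph_dist_ge:
  assumes "\<And>p. awalk u p v \<Longrightarrow> k \<le> length p"
  shows "ereal k \<le> graph_dist G u v"
proof -
  have "awalk_cost (\<lambda>_. 1) p = length p" for p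
    by (simp add: awalk_cost_def sum_list_triv)
  then show ?thesis
    unfolding graph_dist_def \<mu>_def using assms by (intro INF_greatest) simp
qed

text \<open>
  A common neighbour bounds the distance of two distinct non-adjacent vertices by 2, while equal
  or adjacent vertices are never at distance 2.
\<close>

lemma metamour_complementaryI:
  assumes "pair_graph G"
    and common: "\<And>u v. u \<in> pverts G \<Longrightarrow> v \<in> pverts G \<Longrightarrow> u \<noteq> v \<Longrightarrow> (u, v) \<notin> parcs G \<Longrightarrow>
      \<exists>w. (u, w) \<in> parcs G \<and> (w, v) \<in> parcs G"
  shows "metamour_complementary G"
proof -
  interpret pair_graph G by fact
  have "graph_dist G u v = 2 \<longleftrightarrow> u \<noteq> v \<and> (u, v) \<notin> parcs G"
    if u: "u \<in> pverts G" and v: "v \<in> pverts G" for u v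
  proof (cases "u \<noteq> v \<and> (u, v) \<notin> parcs G")
    case True
    then obtain w where w: "(u, w) \<in> parcs G" "(w, v) \<in> parcs G"
      using common u v by blast
    then have "awalk u [(u, w), (w, v)] v"
      using u v by (simp add: awalk_def)
    then have "graph_dist G u v \<le> 2"
      using graph_dist_le_length[of u "[(u, w), (w, v)]" v] by simp
    moreover have "2 \<le> length p" if "awalk u p v" for p
    proof (rule ccontr)
      assume "\<not> 2 \<le> length p"
      then consider "p = []" | e where "p = [e]"
        by (cases p; cases "tl p") auto
      then show False
        using that True by cases (auto simp: awalk_def)
    qed
    then have "2 \<le> graph_dist G u v"
      using graph_dist_ge[of u v 2] by simp
    ultimately show ?thesis
      using True by auto
  next
    case False
    then have "\<exists>p. awalk u p v \<and> length p \<le> 1"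
    proof (cases "u = v")
      case True
      then show ?thesis using u by (intro exI[of _ "[]"]) (simp add: awalk_def)
    next
      case neq: False
      then show ?thesis using u False by (intro exI[of _ "[(u, v)]"]) (simp add: awalk_def)
    qed
    then obtain p where p: "awalk u p v" "length p \<le> 1"
      by blast
    then have "graph_dist G u v \<le> ereal (real (length p))"
      by (intro graph_dist_le_length)
    also have "\<dots> < 2"
      using p(2) by simp
    finally have "graph_dist G u v < 2" .
    then show ?thesis using False by auto
  qed
  then show ?thesis
    unfolding metamour_complementary_def metamour_graph_def graph_complement_def by auto
qed

lemma digraph_isoI:
  assumes "pair_wf_digraph G"
    and bij: "bij_betw f (pverts G) (pverts H)"
    and wf: "parcs H \<subseteq> pverts H \<times> pverts H"
    and arcs: "\<And>u v. u \<in> pverts G \<Longrightarrow> v \<in> pverts G \<Longrightarrow> (f u, f v) \<in> parcs H \<longleftrightarrow> (u, v) \<in> parcs G"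
  shows "digraph_iso (with_proj G) (with_proj H)"
proof -
  interpret pair_wf_digraph G by fact
  let ?f = "\<lparr>iso_verts = f, iso_arcs = map_prod f f, iso_head = snd, iso_tail = fst\<rparr>"
  have sub: "parcs G \<subseteq> pverts G \<times> pverts G"
    using wellformed' by auto
  have inj: "inj_on f (pverts G)"
    using bij by (rule bij_betw_imp_inj_on)
  then have "inj_on (map_prod f f) (pverts G \<times> pverts G)"
    by (intro map_prod_inj_on)
  then have "inj_on (map_prod f f) (parcs G)"
    using sub by (rule inj_on_subset)
  then have "digraph_isomorphism ?f"
    using inj wf_digraph_axioms by (simp add: digraph_isomorphism_def)
  moreover have "map_prod f f ` parcs G = parcs H"
  proof
    show "map_prod f f ` parcs G \<subseteq> parcs H"
      using arcs sub by fastforce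
    show "parcs H \<subseteq> map_prod f f ` parcs G"
    proof
      fix e assume e: "e \<in> parcs H"
      then obtain u v where "u \<in> pverts G" "v \<in> pverts G" "e = (f u, f v)"
        using wf bij_betw_imp_surj_on[OF bij] by blast
      with e show "e \<in> map_prod f f ` parcs G"
        using arcs by (intro image_eqI[of _ _ "(u, v)"]) auto
    qed
  qed
  then have "with_proj H = app_iso ?f (with_proj G)"
    using bij_betw_imp_surj_on[OF bij] by (simp add: app_iso_def with_proj_def)
  ultimately show ?thesis
    unfolding digraph_iso_def by blast
qed

section \<open>Substitution into the pentagon\<close>

definition pentagon :: "nat \<Rightarrow> nat \<Rightarrow> bool" where
  "pentagon a b \<longleftrightarrow> (int a - int b)\<^sup>2 mod 5 = 1"

lemma less_5_cases: "(a::nat) < 5 \<longleftrightarrow> a = 0 \<or> a = 1 \<or> a = 2 \<or> a = 3 \<or> a = 4"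
  by auto

lemma pentagon_sym: "pentagon a b \<longleftrightarrow> pentagon b a"
  by (simp add: pentagon_def power2_commute)

text \<open>\<open>(2d)\<^sup>2 = - d\<^sup>2\<close> modulo 5, and a nonzero square modulo 5 is 1 or \<open>-1\<close>.\<close>

lemma pentagon_double:
  assumes "a < 5" "b < 5" "a \<noteq> b"
  shows "pentagon (2 * a mod 5) (2 * b mod 5) \<longleftrightarrow> \<not> pentagon a b"
  using assms unfolding less_5_cases pentagon_def by (elim disjE) simp_all

lemma pentagon_common_neighbour:
  assumes "a < 5" "b < 5" "\<not> pentagon a b"
  shows "\<exists>c<5. pentagon a c \<and> pentagon c b"
proof -
  \<comment> \<open>The midpoint of distinct non-adjacent vertices is adjacent to both, as 1/2 is a non-square.\<close>
  define c where "c = (if a = b then (a + 1) mod 5 else 3 * (a + b) mod 5)"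
  have "pentagon a c \<and> pentagon c b"
    using assms unfolding less_5_cases pentagon_def c_def by (elim disjE) simp_all
  moreover have "c < 5"
    by (simp add: c_def)
  ultimately show ?thesis by blast
qed

text \<open>
  The vertex \<open>4 * i + k\<close> with \<open>k < 4\<close> has index \<open>i\<close> in the copy over the residue \<open>2 ^ k mod 5\<close>, so
  that doubling the residue is the cyclic shift of \<open>k\<close>. The single vertex over the residue 0 is
  \<open>4 * n\<close>.
\<close>

definition residue :: "nat \<Rightarrow> nat \<Rightarrow> nat" where
  "residue n v = (if v = 4 * n then 0 else 2 ^ (v mod 4) mod 5)"

definition turn :: "nat \<Rightarrow> nat \<Rightarrow> nat" where
  "turn n v = (if v = 4 * n then v else 4 * (v div 4) + (v + 1) mod 4)"

text \<open>
  The nonzero squares modulo 5 are 1 and 4. Over the residue 0 there is only one vertex, so that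
  \<open>u \<noteq> v\<close> excludes an arc there whatever \<open>E\<close> says about the index \<open>n\<close>.
\<close>

definition blowup :: "nat \<Rightarrow> (nat \<Rightarrow> nat \<Rightarrow> bool) \<Rightarrow> nat pair_pre_digraph" where
  "blowup n E = \<lparr> pverts = {..4 * n},
    parcs = {(u, v). u \<le> 4 * n \<and> v \<le> 4 * n \<and>
      (if residue n u = residue n v
       then u \<noteq> v \<and> (E (u div 4) (v div 4) \<longleftrightarrow> residue n u \<in> {1, 4})
       else pentagon (residue n u) (residue n v))} \<rparr>"

lemma pverts_blowup [simp]: "pverts (blowup n E) = {..4 * n}"
  by (simp add: blowup_def)

lemma parcs_blowup:
  "(u, v) \<in> parcs (blowup n E) \<longleftrightarrow> u \<le> 4 * n \<and> v \<le> 4 * n \<and>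
    (if residue n u = residue n v
     then u \<noteq> v \<and> (E (u div 4) (v div 4) \<longleftrightarrow> residue n u \<in> {1, 4})
     else pentagon (residue n u) (residue n v))"
  by (simp add: blowup_def)

lemma mod_4_cases: "(v::nat) mod 4 = 0 \<or> v mod 4 = 1 \<or> v mod 4 = 2 \<or> v mod 4 = 3"
  by presburger

lemma residue_less: "residue n v < 5"
  by (simp add: residue_def)

lemma residue_eq_0_iff: "residue n v = 0 \<longleftrightarrow> v = 4 * n"
  using mod_4_cases[of v] by (auto simp: residue_def)

lemma residue_index_inj:
  assumes "residue n u = residue n v" "u div 4 = v div 4"
  shows "u = v"
proof (cases "residue n v = 0")
  case True
  then show ?thesis using assms by (metis residue_eq_0_iff)
next
  case False
  then have "u \<noteq> 4 * n" "v \<noteq> 4 * n"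
    using assms(1) residue_eq_0_iff by metis+
  then have "(2::nat) ^ (u mod 4) mod 5 = 2 ^ (v mod 4) mod 5"
    using assms by (simp add: residue_def)
  then have "u mod 4 = v mod 4"
    using mod_4_cases[of u] mod_4_cases[of v] by (elim disjE) simp_all
  then show ?thesis
    using assms(2) by (metis div_mult_mod_eq)
qed

lemma residue_surj:
  assumes "0 < n" "c < 5"
  shows "\<exists>v\<le>4 * n. residue n v = c"
proof -
  have "residue n (4 * n) = 0" "residue n 0 = 1" "residue n 1 = 2" "residue n 2 = 4"
    "residue n 3 = 3"
    using assms(1) by (auto simp: residue_def; presburger)+
  moreover have "3 \<le> 4 * n"
    using assms(1) by simp
  ultimately show ?thesis
    using assms(2) unfolding less_5_cases
    by (metis le0 le_refl le_trans one_le_numeral numeral_le_iff semiring_norm(69,72,68))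
qed

lemma turn_div_4: "turn n v div 4 = v div 4"
  by (simp add: turn_def)

lemma turn_less:
  assumes "v < 4 * n"
  shows "turn n v < 4 * n"
proof -
  have "v div 4 < n"
    using assms by (simp add: less_mult_imp_div_less mult.commute)
  moreover have "(v + 1) mod 4 < 4"
    by simp
  ultimately have "4 * (v div 4) + (v + 1) mod 4 < 4 * n"
    by linarith
  then show ?thesis
    using assms by (simp add: turn_def)
qed

lemma turn_le: "v \<le> 4 * n \<Longrightarrow> turn n v \<le> 4 * n"
  using turn_less[of v n] by (cases "v = 4 * n") (auto simp: turn_def)

lemma residue_turn:
  assumes "v \<le> 4 * n"
  shows "residue n (turn n v) = 2 * residue n v mod 5"
proof (cases "v = 4 * n")
  case True
  then show ?thesis by (simp add: turn_def residue_def)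
next
  case False
  then have "turn n v < 4 * n"
    using assms by (intro turn_less) simp
  then have "residue n (turn n v) = 2 ^ (turn n v mod 4) mod 5"
    by (simp add: residue_def)
  moreover have "turn n v mod 4 = (v + 1) mod 4"
    using False by (simp add: turn_def)
  moreover have "(2::nat) ^ ((v + 1) mod 4) mod 5 = 2 * (2 ^ (v mod 4) mod 5) mod 5"
    using mod_4_cases[of v] by (elim disjE) (simp_all add: mod_Suc)
  ultimately show ?thesis
    using False by (simp add: residue_def)
qed

lemma double_residue_eq_iff:
  assumes "a < 5" "b < 5"
  shows "2 * a mod 5 = 2 * b mod 5 \<longleftrightarrow> a = (b::nat)"
  using assms unfolding less_5_cases by (elim disjE) simp_all

lemma turn_inj: "inj_on (turn n) {..4 * n}"
proof (rule inj_onI)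
  fix u v assume *: "u \<in> {..4 * n}" "v \<in> {..4 * n}" "turn n u = turn n v"
  then have "residue n u = residue n v"
    using residue_turn[of u n] residue_turn[of v n]
    by (simp add: double_residue_eq_iff residue_less)
  moreover have "u div 4 = v div 4"
    using * by (metis turn_div_4)
  ultimately show "u = v" by (rule residue_index_inj)
qed

lemma bij_betw_turn: "bij_betw (turn n) {..4 * n} {..4 * n}"
  unfolding bij_betw_def
  using turn_inj turn_le by (intro conjI endo_inj_surj) auto

text \<open>
  Over different residues this is the complementarity of the pentagon. Over one nonzero residue,
  doubling exchanges the squares with the non-squares, hence \<open>E\<close> with its complement.
\<close>

lemma arcs_blowup_turn:
  assumes "u \<le> 4 * n" "v \<le> 4 * n" "u \<noteq> v"
  shows "(turn n u, turn n v) \<in> parcs (blowup n E) \<longleftrightarrow> (u, v) \<notin> parcs (blowup n E)"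
proof -
  have neq: "turn n u \<noteq> turn n v"
    using assms inj_onD[OF turn_inj, of n u v] by auto
  show ?thesis
  proof (cases "residue n u = residue n v")
    case True
    with assms(3) have "residue n u \<noteq> 0"
      by (metis residue_eq_0_iff)
    then have "2 * residue n u mod 5 \<in> {1, 4} \<longleftrightarrow> residue n u \<notin> {1, 4}"
      using residue_less[of n u] unfolding less_5_cases by (elim disjE) simp_all
    then show ?thesis
      using True assms neq by (auto simp: parcs_blowup residue_turn turn_div_4 turn_le)
  next
    case False
    then show ?thesis
      using assms
      by (simp add: parcs_blowup residue_turn turn_le double_residue_eq_iff residue_less
          pentagon_double)
  qed
qed

lemma pair_graph_blowup:
  assumes "symp E"
  shows "pair_graph (blowup n E)"
proof -
  have sub: "parcs (blowup n E) \<subseteq> {..4 * n} \<times> {..4 * n}"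
    by (auto simp: blowup_def)
  show ?thesis
  proof
    show "finite (parcs (blowup n E))"
      using sub by (rule finite_subset) simp
    have "sym (parcs (blowup n E))"
      using sympD[OF assms] by (intro symI) (auto simp: parcs_blowup pentagon_sym split: if_splits)
    then show "symmetric (with_proj (blowup n E))"
      by (simp add: symmetric_def)
  qed (use sub in \<open>auto simp: parcs_blowup\<close>)
qed

lemma self_complementary_blowup:
  assumes "symp E"
  shows "self_complementary (blowup n E)"
proof -
  interpret pair_graph "blowup n E"
    using assms by (rule pair_graph_blowup)
  show ?thesis
    unfolding self_complementary_def
  proof (rule digraph_isoI[of _ "turn n"])
    show "pair_wf_digraph (blowup n E)" ..
    show "bij_betw (turn n) (pverts (blowup n E)) (pverts (graph_complement (blowup n E)))"
      by (simp add: graph_complement_def bij_betw_turn)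
    fix u v assume "u \<in> pverts (blowup n E)" "v \<in> pverts (blowup n E)"
    then have *: "u \<le> 4 * n" "v \<le> 4 * n" by auto
    show "(turn n u, turn n v) \<in> parcs (graph_complement (blowup n E)) \<longleftrightarrow>
        (u, v) \<in> parcs (blowup n E)"
    proof (cases "u = v")
      case True
      then show ?thesis by (simp add: graph_complement_def parcs_blowup)
    next
      case False
      then show ?thesis
        using * arcs_blowup_turn[OF * False] inj_onD[OF turn_inj, of n u v]
        by (auto simp: graph_complement_def turn_le)
    qed
  qed (auto simp: graph_complement_def)
qed

lemma metamour_complementary_blowup:
  assumes "symp E"
  shows "metamour_complementary (blowup n E)"
proof (rule metamour_complementaryI)
  show "pair_graph (blowup n E)"
    using assms by (rule pair_graph_blowup)
next
  fix u v assume "u \<in> pverts (blowup n E)" "v \<in> pverts (blowup n E)" "u \<noteq> v"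
    and nonadj: "(u, v) \<notin> parcs (blowup n E)"
  then have uv: "u \<le> 4 * n" "v \<le> 4 * n" "0 < n"
    by auto
  have "\<not> pentagon (residue n u) (residue n v)"
    using nonadj uv by (cases "residue n u = residue n v") (simp_all add: parcs_blowup pentagon_def)
  then obtain c where c: "c < 5" "pentagon (residue n u) c" "pentagon c (residue n v)"
    using pentagon_common_neighbour residue_less by metis
  moreover obtain w where "w \<le> 4 * n" "residue n w = c"
    using residue_surj uv(3) c(1) by blast
  moreover have "\<not> pentagon a a" for a
    by (simp add: pentagon_def)
  ultimately have "(u, w) \<in> parcs (blowup n E) \<and> (w, v) \<in> parcs (blowup n E)"
    using uv by (auto simp: parcs_blowup)
  then show "\<exists>w. (u, w) \<in> parcs (blowup n E) \<and> (w, v) \<in> parcs (blowup n E)"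
    by blast
qed

text \<open>
  The copy over the residue 1 serves as the induced copy of \<open>G\<close>: it consists of the vertices
  \<open>4 * i\<close> with \<open>i < n\<close>.
\<close>

lemma embeds_induced_blowup:
  assumes "pair_graph G" "symp E"
    and f: "bij_betw f (pverts G) {..<n}"
    and E: "\<And>u v. u \<in> pverts G \<Longrightarrow> v \<in> pverts G \<Longrightarrow> E (f u) (f v) \<longleftrightarrow> (u, v) \<in> parcs G"
  shows "embeds_induced G (blowup n E)"
proof -
  interpret G: pair_graph G by fact
  interpret B: pair_graph "blowup n E"
    using assms(2) by (rule pair_graph_blowup)
  define W where "W = (\<lambda>i. 4 * i) ` {..<n}"
  define H where "H = \<lparr> pverts = W, parcs = parcs (blowup n E) \<inter> W \<times> W \<rparr>"
  have W: "W \<subseteq> {..4 * n}"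
    by (auto simp: W_def)
  have "pair_wf_digraph H"
    by unfold_locales (auto simp: H_def)
  then have "wf_digraph (with_proj H)"
    by (simp add: wf_digraph_wp_iff)
  then have "induced_subgraph (with_proj H) (with_proj (blowup n E))"
    using W B.wf_digraph_axioms
    by (auto simp: induced_subgraph_def subgraph_def compatible_def H_def)
  moreover have "digraph_iso (with_proj G) (with_proj H)"
  proof (rule digraph_isoI[of _ "\<lambda>v. 4 * f v"])
    show "pair_wf_digraph G" ..
    have "bij_betw (\<lambda>i. 4 * i) {..<n} W"
      by (auto simp: W_def bij_betw_def inj_on_def)
    with f show "bij_betw (\<lambda>v. 4 * f v) (pverts G) (pverts H)"
      by (auto simp: H_def dest: bij_betw_trans simp: comp_def)
    fix u v assume uv: "u \<in> pverts G" "v \<in> pverts G"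
    then have less: "f u < n" "f v < n"
      using bij_betwE[OF f] by auto
    then have "residue n (4 * f u) = 1" "residue n (4 * f v) = 1"
      by (auto simp: residue_def)
    moreover have "f u = f v \<longleftrightarrow> u = v"
      using uv bij_betw_imp_inj_on[OF f] by (auto dest: inj_onD)
    moreover have "(u, v) \<in> parcs G \<Longrightarrow> u \<noteq> v"
      by (rule G.no_loops')
    ultimately show "(4 * f u, 4 * f v) \<in> parcs H \<longleftrightarrow> (u, v) \<in> parcs G"
      using less uv by (auto simp: H_def W_def parcs_blowup E)
  qed (auto simp: H_def)
  ultimately show ?thesis
    unfolding embeds_induced_def by blast
qed

theorem theorem4p5:
  fixes G :: "'a pair_pre_digraph"
  assumes "pair_graph G"
  shows "\<exists>G' :: nat pair_pre_digraph.
    pair_graph G' \<and>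
    embeds_induced G G' \<and>
    metamour_complementary G' \<and>
    self_complementary G' \<and>
    card (pverts G') = 4 * card (pverts G) + 1"
proof -
  interpret pair_graph G by fact
  define n where "n = card (pverts G)"
  obtain f where f: "bij_betw f (pverts G) {..<n}"
    using ex_bij_betw_finite_nat[OF pair_finite_verts] by (auto simp: n_def atLeast0LessThan)
  define g where "g = the_inv_into (pverts G) f"
  define E where "E i j \<longleftrightarrow> (g i, g j) \<in> parcs G" for i j
  have "symp E"
    by (auto simp: symp_def E_def intro: arcs_symmetric)
  moreover have "g (f v) = v" if "v \<in> pverts G" for v
    using f that by (simp add: g_def the_inv_into_f_f bij_betw_imp_inj_on)
  then have "embeds_induced G (blowup n E)"
    using assms \<open>symp E\<close> f by (intro embeds_induced_blowup) (auto simp: E_def)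
  ultimately show ?thesis
    using pair_graph_blowup metamour_complementary_blowup self_complementary_blowup
    by (intro exI[of _ "blowup n E"]) (simp add: n_def)
qed

end
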